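(* Let $n \geq 1$ be an integer and let $f : \mathbb{R}^{n} \to \mathbb{R}_{+}$ be continuous and nonzero. Then there exist nonzero smooth functions $g_{1}, g_{2}, \dots : \mathbb{R}^{n} \to \mathbb{R}_{+}$ such that (i) $f(x) \geq \sum_{j \in \mathbb{N}} g_{j}(x)$ for all $x \in \mathbb{R}^{n}$; and (ii) for every compact $K \subset \mathbb{R}^{n}$, the series $\sum_{j \in \mathbb{N}} g_{j}$ converges uniformly on $K$ (to a function bounded above by $f$ on $K$).
   Context: $\mathbb{R}_{+} = \{x \in \mathbb{R} \mid x \geq 0\}$ and $\mathbb{N} = \{1,2,3,\dots\}$. A function is nonzero if it is not identically zero. Smooth means infinitely differentiable ($C^{\infty}$). *)

theory Defs
  imports "HOL-Analysis.Analysis"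
begin

(* In finite dimension, f is of class C^(k+1) iff it is differentiable everywhere and,
   for every fixed direction v, x |-> Df(x)v is of class C^k. *)
primrec C_class :: "nat \<Rightarrow> ('a::euclidean_space \<Rightarrow> 'b::euclidean_space) \<Rightarrow> bool" where
  "C_class 0 f \<longleftrightarrow> continuous_on UNIV f"
| "C_class (Suc k) f \<longleftrightarrow>
     (\<forall>x. f differentiable (at x)) \<and>
     (\<forall>v. C_class k (\<lambda>x. frechet_derivative f (at x) v))"

definition smooth :: "('a::euclidean_space \<Rightarrow> 'b::euclidean_space) \<Rightarrow> bool" where
  "smooth f \<longleftrightarrow> (\<forall>k. C_class k f)"

end

theory Submission
  imports Defs
begin

text \<open>
  The series only has to stay below \<open>f\<close>, so a single bump function suffices: if \<open>h\<close> is smooth,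
  nonzero and \<open>0 \<le> h \<le> f\<close>, the functions \<open>h / 2 ^ (j + 1)\<close> sum to \<open>h\<close>, and the convergence is
  uniform on all of space by the Weierstrass M-test because \<open>h\<close> is bounded. To find \<open>h\<close>,
  let \<open>f x0 > 0\<close>; by continuity \<open>f \<ge> c\<close> on a ball of radius \<open>r\<close> about \<open>x0\<close>, with
  \<open>c = f x0 / 2 > 0\<close>, and
  \<open>h x = c * exp (- 1 / q x)\<close> where \<open>q x = r\<^sup>2 - \<bar>x - x0\<bar>\<^sup>2 > 0\<close>, extended by \<open>0\<close>, will do
  (\<open>smooth_minorant_exists\<close>).

  Smoothness is proved for all the functions \<open>exp (- 1 / t) / t ^ m\<close> together (extended by
  \<open>0\<close> to \<open>t \<le> 0\<close>): the derivative of each is a linear combination of two others, so that induction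
  on the differentiability class (\<open>C_class_flat_comp\<close>) needs only the chain rule and closure of the
  class \<open>C^k\<close> under sums and products.
\<close>

section \<open>Closure properties of the class C^k\<close>

lemma C_class_SucI:
  assumes "\<And>x. (f has_derivative f' x) (at x)"
    and "\<And>v. C_class k (\<lambda>x. f' x v)"
  shows "C_class (Suc k) f"
proof -
  have "frechet_derivative f (at x) = f' x" for x
    using frechet_derivative_at[OF assms(1)] by simp
  then show ?thesis
    using assms by (auto simp: differentiable_def)
qed

lemma C_class_Suc_has_derivative:
  assumes "C_class (Suc k) f"
  shows "(f has_derivative frechet_derivative f (at x)) (at x)"
  using assms by (simp add: frechet_derivative_works)

lemma C_class_SucD: "C_class (Suc k) f \<Longrightarrow> C_class k f"
proof (induction k arbitrary: f)
  case 0
  then show ?case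
    by (auto intro: differentiable_imp_continuous_within simp: continuous_on_eq_continuous_within)
next
  case (Suc k)
  then show ?case by (metis C_class.simps(2))
qed

lemma C_class_const: "C_class k (\<lambda>x. c)"
proof (induction k arbitrary: c)
  case (Suc k)
  show ?case
    by (rule C_class_SucI[where f' = "\<lambda>x v. 0"]) (auto intro: Suc)
qed simp

lemma C_class_add:
  "C_class k f \<Longrightarrow> C_class k g \<Longrightarrow> C_class k (\<lambda>x. f x + g x)"
proof (induction k arbitrary: f g)
  case 0
  then show ?case by (auto intro: continuous_intros)
next
  case (Suc k)
  show ?case
  proof (rule C_class_SucI)
    show "((\<lambda>x. f x + g x) has_derivative
        (\<lambda>v. frechet_derivative f (at x) v + frechet_derivative g (at x) v)) (at x)" for x
      by (intro has_derivative_add C_class_Suc_has_derivative[OF Suc.prems(1)]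
          C_class_Suc_has_derivative[OF Suc.prems(2)])
    show "C_class k (\<lambda>x. frechet_derivative f (at x) v + frechet_derivative g (at x) v)" for v
      using Suc by simp
  qed
qed

lemma C_class_mult:
  fixes f g :: "'a::euclidean_space \<Rightarrow> real"
  shows "C_class k f \<Longrightarrow> C_class k g \<Longrightarrow> C_class k (\<lambda>x. f x * g x)"
proof (induction k arbitrary: f g)
  case 0
  then show ?case by (auto intro: continuous_intros)
next
  case (Suc k)
  show ?case
  proof (rule C_class_SucI)
    show "((\<lambda>x. f x * g x) has_derivative
        (\<lambda>v. f x * frechet_derivative g (at x) v + frechet_derivative f (at x) v * g x)) (at x)" for x
      by (intro has_derivative_mult C_class_Suc_has_derivative[OF Suc.prems(1)]
          C_class_Suc_has_derivative[OF Suc.prems(2)])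
    show "C_class k (\<lambda>x. f x * frechet_derivative g (at x) v + frechet_derivative f (at x) v * g x)" for v
    proof (rule C_class_add)
      show "C_class k (\<lambda>x. f x * frechet_derivative g (at x) v)"
        by (rule Suc.IH) (use Suc.prems C_class_SucD in auto)
      show "C_class k (\<lambda>x. frechet_derivative f (at x) v * g x)"
        by (rule Suc.IH) (use Suc.prems C_class_SucD in auto)
    qed
  qed
qed

lemma C_class_inner_right: "C_class k (\<lambda>x. (x - a) \<bullet> v)"
proof (cases k)
  case 0
  then show ?thesis by (auto intro!: continuous_intros)
next
  case (Suc l)
  have "C_class (Suc l) (\<lambda>x. (x - a) \<bullet> v)"
    by (rule C_class_SucI[where f' = "\<lambda>x w. w \<bullet> v"])
      (auto intro!: derivative_eq_intros C_class_const)
  then show ?thesis by (simp add: Suc)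
qed

lemma C_class_norm_squared: "C_class k (\<lambda>x. (x - a) \<bullet> (x - a))"
proof (cases k)
  case 0
  then show ?thesis by (auto intro!: continuous_intros)
next
  case (Suc l)
  have "C_class (Suc l) (\<lambda>x. (x - a) \<bullet> (x - a))"
  proof (rule C_class_SucI)
    show "((\<lambda>x. (x - a) \<bullet> (x - a)) has_derivative (\<lambda>v. 2 * ((x - a) \<bullet> v))) (at x)" for x
      by (auto intro!: derivative_eq_intros simp: inner_commute)
    show "C_class l (\<lambda>x. 2 * ((x - a) \<bullet> v))" for v
      by (intro C_class_mult C_class_const C_class_inner_right)
  qed
  then show ?thesis by (simp add: Suc)
qed

section \<open>The flat function and its derivatives\<close>

text \<open>
  The classical flat function is the case \<open>m = 0\<close>; division by \<open>t ^ m\<close> produces all the terms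
  that occur in its higher derivatives.
\<close>

definition flat :: "nat \<Rightarrow> real \<Rightarrow> real" where
  "flat m t = (if t > 0 then exp (- 1 / t) / t ^ m else 0)"

lemma flat_nonneg: "0 \<le> flat m t"
  by (simp add: flat_def)

text \<open>Quadratic vanishing at \<open>0\<close> gives derivative \<open>0\<close> there, where the two pieces meet.\<close>

lemma flat_le_square: "flat m t \<le> fact (m + 2) * t\<^sup>2"
proof (cases "t > 0")
  case True
  \<comment> \<open>one term of the exponential series at \<open>1 / t\<close> bounds \<open>exp (1 / t)\<close> from below\<close>
  have "(1 / t) ^ (m + 2) / fact (m + 2) \<le> exp (1 / t)"
    using sum_le_suminf[OF sums_summable[OF exp_converges[of "1 / t"]], of "{m + 2}"]
      sums_unique[OF exp_converges[of "1 / t"]] True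
    by (simp add: divide_inverse mult.commute)
  moreover have "(fact (m + 2) :: real) > 0"
    by (rule fact_gt_zero)
  ultimately show ?thesis
    using True by (simp add: flat_def exp_minus field_simps power_add power2_eq_square del: fact_Suc)
qed (simp add: flat_def)

lemma flat_has_real_derivative:
  "(flat m has_real_derivative (flat (m + 2) t - real m * flat (m + 1) t)) (at t)"
proof -
  consider "t > 0" | "t < 0" | "t = 0" by linarith
  then show ?thesis
  proof cases
    case 1
    have "((\<lambda>t. exp (- 1 / t) / t ^ m) has_real_derivative
        (exp (- 1 / t) * (1 / t\<^sup>2) * t ^ m - exp (- 1 / t) * (real m * t ^ (m - 1))) / (t ^ m)\<^sup>2)
        (at t)"
      using 1 by (intro derivative_eq_intros refl) (simp_all, simp add: power2_eq_square)
    also have "(exp (- 1 / t) * (1 / t\<^sup>2) * t ^ m - exp (- 1 / t) * (real m * t ^ (m - 1))) / (t ^ m)\<^sup>2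
        = flat (m + 2) t - real m * flat (m + 1) t"
      using 1 by (cases m) (simp_all add: flat_def field_simps power2_eq_square)
    finally have "((\<lambda>t. exp (- 1 / t) / t ^ m) has_real_derivative
        (flat (m + 2) t - real m * flat (m + 1) t)) (at t)" .
    then show ?thesis
      by (rule has_field_derivative_transform_within_open[where S = "{0<..}"])
        (use 1 in \<open>auto simp: flat_def\<close>)
  next
    case 2
    have "((\<lambda>t. 0) has_real_derivative (flat (m + 2) t - real m * flat (m + 1) t)) (at t)"
      using 2 by (simp add: flat_def)
    then show ?thesis
      by (rule has_field_derivative_transform_within_open[where S = "{..<0}"])
        (use 2 in \<open>auto simp: flat_def\<close>)
  next
    case 3
    have "((\<lambda>h. flat m h / h) \<longlongrightarrow> 0) (at 0)"
    proof (rule Lim_null_comparison)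
      have "norm (flat m h / h) \<le> fact (m + 2) * \<bar>h\<bar>" if "h \<noteq> 0" for h
      proof -
        have "flat m h \<le> (fact (m + 2) * \<bar>h\<bar>) * \<bar>h\<bar>"
          using flat_le_square[of m h] by (simp add: power2_eq_square mult.assoc del: fact_Suc)
        then show ?thesis
          using that flat_nonneg[of m h] by (simp add: pos_divide_le_eq del: fact_Suc)
      qed
      then show "\<forall>\<^sub>F h in at 0. norm (flat m h / h) \<le> fact (m + 2) * \<bar>h\<bar>"
        by (simp add: eventually_at_filter)
      show "((\<lambda>h::real. fact (m + 2) * \<bar>h\<bar>) \<longlongrightarrow> 0) (at 0)"
        by (auto intro!: tendsto_eq_intros)
    qed
    then show ?thesis
      using 3 by (simp add: DERIV_def flat_def)
  qed
qed

text \<open>All exponents \<open>m\<close> are treated at once, since differentiation raises \<open>m\<close>.\<close>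

lemma C_class_flat_comp:
  assumes "\<And>k. C_class k q"
  shows "C_class k (\<lambda>x. flat m (q x))"
proof (induction k arbitrary: m)
  case 0
  have "continuous_on UNIV (flat m)"
    using DERIV_isCont[OF flat_has_real_derivative] by (simp add: continuous_on_eq_continuous_at)
  moreover have "continuous_on UNIV q"
    using assms[of 0] by simp
  ultimately show ?case
    by (auto intro: continuous_on_compose2)
next
  case (Suc k)
  let ?D = "\<lambda>x. flat (m + 2) (q x) + (- real m) * flat (m + 1) (q x)"
  show ?case
  proof (rule C_class_SucI)
    have "(flat m has_derivative (*) (?D x)) (at (q x))" for x
      using flat_has_real_derivative[of m "q x"] by (simp add: has_field_derivative_def)
    then show "((\<lambda>x. flat m (q x)) has_derivative
        (\<lambda>v. ?D x * frechet_derivative q (at x) v)) (at x)" for x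
      using has_derivative_compose C_class_Suc_has_derivative[OF assms] by blast
    have "C_class k (\<lambda>x. frechet_derivative q (at x) v)" for v
      using assms[of "Suc k"] by simp
    then show "C_class k (\<lambda>x. ?D x * frechet_derivative q (at x) v)" for v
      by (intro C_class_mult C_class_add C_class_const Suc)
  qed
qed

section \<open>Bump functions and the series\<close>

lemma smooth_scale:
  fixes h :: "'a::euclidean_space \<Rightarrow> real"
  shows "smooth h \<Longrightarrow> smooth (\<lambda>x. a * h x)"
  by (auto simp: smooth_def intro: C_class_mult C_class_const)

lemma smooth_bump_exists:
  fixes a :: "'a::euclidean_space" and r :: real
  assumes "r > 0"
  obtains h :: "'a \<Rightarrow> real" where "smooth h" "\<And>x. 0 \<le> h x" "\<And>x. h x \<le> 1" "0 < h a"
    "\<And>x. x \<notin> ball a r \<Longrightarrow> h x = 0"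
proof
  let ?q = "\<lambda>x. r\<^sup>2 + (- 1) * ((x - a) \<bullet> (x - a))"
  let ?h = "\<lambda>x. flat 0 (?q x)"
  have "C_class k ?q" for k
    by (intro C_class_add C_class_mult C_class_const C_class_norm_squared)
  then show "smooth ?h"
    unfolding smooth_def using C_class_flat_comp by blast
  show "0 \<le> ?h x" for x by (rule flat_nonneg)
  show "?h x \<le> 1" for x by (simp add: flat_def)
  show "0 < ?h a" using assms by (simp add: flat_def)
  show "?h x = 0" if "x \<notin> ball a r" for x
  proof -
    have "r\<^sup>2 \<le> (norm (x - a))\<^sup>2"
      using that assms by (intro power_mono) (auto simp: dist_norm norm_minus_commute)
    then show ?thesis by (simp add: flat_def dot_square_norm)
  qed
qed

lemma smooth_minorant_exists:
  fixes f :: "'a::euclidean_space \<Rightarrow> real"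
  assumes "continuous_on UNIV f" and "\<And>x. 0 \<le> f x" and "f a \<noteq> 0"
  obtains h c where "smooth h" "\<And>x. 0 \<le> h x" "\<And>x. h x \<le> f x" "\<And>x. h x \<le> c" "0 < h a"
proof -
  define c where "c = f a / 2"
  have c: "0 < c" "c < f a"
    using assms(2)[of a] assms(3) by (auto simp: c_def)
  have "open {x. c < f x}"
    using assms(1) by (intro open_Collect_less) auto
  with c obtain r where r: "r > 0" "ball a r \<subseteq> {x. c < f x}"
    using open_contains_ball by blast
  obtain b :: "'a \<Rightarrow> real" where b: "smooth b" "\<And>x. 0 \<le> b x" "\<And>x. b x \<le> 1" "0 < b a"
    "\<And>x. x \<notin> ball a r \<Longrightarrow> b x = 0"
    using smooth_bump_exists[OF r(1), of a] by metis
  have le: "c * b x \<le> c" for x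
    using b(3)[of x] c by simp
  show thesis
  proof (rule that[of "\<lambda>x. c * b x" c])
    show "smooth (\<lambda>x. c * b x)" using b(1) by (rule smooth_scale)
    show "0 \<le> c * b x" for x using b c by simp
    show "c * b x \<le> f x" for x
    proof (cases "x \<in> ball a r")
      case True
      then have "c < f x" using r(2) by blast
      then show ?thesis using le[of x] by linarith
    qed (use b(5) assms(2) in simp)
    show "c * b x \<le> c" for x by (rule le)
    show "0 < c * b a" using b c by simp
  qed
qed

theorem proposition2:
  fixes f :: "real ^ 'n \<Rightarrow> real"
  assumes "continuous_on UNIV f"
    and "\<forall>x. 0 \<le> f x"
    and "\<exists>x. f x \<noteq> 0"
  shows "\<exists>g :: nat \<Rightarrow> real ^ 'n \<Rightarrow> real.
    (\<forall>j. smooth (g j) \<and> (\<forall>x. 0 \<le> g j x) \<and> (\<exists>x. g j x \<noteq> 0)) \<and>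
    (\<forall>x. summable (\<lambda>j. g j x) \<and> (\<Sum>j. g j x) \<le> f x) \<and>
    (\<forall>K. compact K \<longrightarrow>
       uniform_limit K (\<lambda>N x. \<Sum>j<N. g j x) (\<lambda>x. \<Sum>j. g j x) sequentially \<and>
       (\<forall>x\<in>K. (\<Sum>j. g j x) \<le> f x))"
proof -
  obtain a where "f a \<noteq> 0" using assms(3) by blast
  then obtain h c where h: "smooth h" "\<And>x. 0 \<le> h x" "\<And>x. h x \<le> f x" "\<And>x. h x \<le> c" "0 < h a"
    using smooth_minorant_exists[of f a] assms(1,2) by metis
  define g where "g j x = (1 / 2) ^ Suc j * h x" for j x
  have sums: "(\<lambda>j. g j x) sums h x" for x
    using sums_mult2[OF power_half_series, of "h x"] by (simp add: g_def)
  have le: "(\<Sum>j. g j x) \<le> f x" for x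
    using sums_unique[OF sums, of x] h(3)[of x] by simp
  have "smooth (g j)" for j
    using smooth_scale[OF h(1), of "(1 / 2) ^ Suc j"] by (simp add: g_def[abs_def])
  moreover have "0 \<le> g j x" for j x
    using h(2) by (simp add: g_def)
  moreover have "\<exists>x. g j x \<noteq> 0" for j
    using h(5) by (intro exI[of _ a]) (simp add: g_def)
  moreover have "summable (\<lambda>j. g j x)" for x
    using sums sums_summable by blast
  moreover have "uniform_limit K (\<lambda>N x. \<Sum>j<N. g j x) (\<lambda>x. \<Sum>j. g j x) sequentially" for K
  proof (rule Weierstrass_m_test)
    show "norm (g j x) \<le> (1 / 2) ^ Suc j * c" for j x
      using h(2)[of x] h(4)[of x] by (simp add: g_def abs_mult divide_right_mono)
    show "summable (\<lambda>j. (1 / 2) ^ Suc j * c)"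
      using sums_mult2[OF power_half_series] sums_summable by blast
  qed
  ultimately show ?thesis
    using le by (intro exI[of _ g]) simp
qed

end
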